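(* Let $n\geq 3$ and $1\leq d<n$, and let $\mathrm{Aut}(\mathbb{Z}_n)$ act on $\mathcal G_n^d$ componentwise. Then: (a) For any $k\in \mathrm{Aut}(\mathbb{Z}_n)$ and any $\mathbf{x}\in\mathcal G_n^d$, $k$ lies in the stabilizer $\mathrm{Stab}(\mathbf{x})$ if and only if $\frac{n}{\gcd(k-1,n)}$ divides $\gcd(\mathbf{x},n)$. In particular, if $\gcd(\mathbf{x},n)=1$ then $\mathrm{Stab}(\mathbf{x})=\{1\}$. (b) The number of orbits of the restricted action of $\mathrm{Aut}(\mathbb{Z}_n)$ on $\mathcal I_n^d$ is $\beta_n^d/\phi(n)$. Thus $\phi(n)$ divides $\beta_n^d$. (c) $\alpha_n^d=\sum_{m\mid n,\ m\geq 1}\beta_m^d$ and $\beta_n^d=\sum_{m\mid n,\ m\geq 1}\mu\left(\frac{n}{m}\right)\alpha_m^d$, where $\mu$ is the Möbius function. (d) If $d\geq \max\{m:\ 1\leq m<n,\ m\mid n\}$, then $\alpha_n^d=\beta_n^d$ and $\phi(n)$ divides $\alpha_n^d$. Moreover, the same conclusion holds if $d\geq n/2$.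
   Context: For a positive integer $m$, $\mathbb{Z}_m$ is the ring of integers modulo $m$, identified with $\{0,1,\dots,m-1\}$. A vector $(v_1,\dots,v_d)\in\mathbb{Z}_m^d$ is zero-sum-free if there is no non-empty subset of its components whose sum is $0$ in $\mathbb{Z}_m$. $\mathcal G_m^d$ denotes the set of zero-sum-free $d$-tuples in $\mathbb{Z}_m^d$ and $\alpha_m^d=|\mathcal G_m^d|$. For $\mathbf{x}=(x_1,\dots,x_d)$, $\gcd(\mathbf{x},m):=\gcd(x_1,\dots,x_d,m)$ (computed with representatives in $\{0,\dots,m-1\}$); $\mathbf{x}\in\mathcal G_m^d$ is irreducible if $\gcd(\mathbf{x},m)=1$. $\mathcal I_m^d$ is the set of irreducible zero-sum-free $d$-tuples in $\mathbb{Z}_m^d$ and $\beta_m^d=|\mathcal I_m^d|$. $\mathrm{Aut}(\mathbb{Z}_n)$ is identified with $\{k: 1\le k\le n-1,\ \gcd(k,n)=1\}$, acting on $d$-tuples by $k\cdot(x_1,\dots,x_d)=(kx_1,\dots,kx_d)$. $\phi$ is Euler's totient function. *)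

theory Defs
  imports Complex_Main "HOL-Algebra.Group_Action" "HOL-Number_Theory.Number_Theory"
    "HOL-Computational_Algebra.Squarefree"
begin

text \<open>
  Elements of \<open>\<int>\<^sub>m\<close> are represented by the naturals \<open>0, \<dots>, m - 1\<close>, and \<open>d\<close>-tuples by lists of
  length \<open>d\<close>. A non-empty subset of the components is a non-empty set of positions, so equal
  entries at different positions count separately.
\<close>

definition zero_sum_free :: "nat \<Rightarrow> nat list \<Rightarrow> bool" where
  "zero_sum_free m x \<longleftrightarrow>
     (\<forall>S. S \<subseteq> {..<length x} \<and> S \<noteq> {} \<longrightarrow> (\<Sum>i\<in>S. x ! i) mod m \<noteq> 0)"

definition zsf_tuples :: "nat \<Rightarrow> nat \<Rightarrow> nat list set" where
  "zsf_tuples m d = {x. length x = d \<and> set x \<subseteq> {0..<m} \<and> zero_sum_free m x}"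

definition alpha :: "nat \<Rightarrow> nat \<Rightarrow> nat" where
  "alpha m d = card (zsf_tuples m d)"

definition gcd_tuple :: "nat list \<Rightarrow> nat \<Rightarrow> nat" where
  "gcd_tuple x m = Gcd (insert m (set x))"

definition irr_tuples :: "nat \<Rightarrow> nat \<Rightarrow> nat list set" where
  "irr_tuples m d = {x \<in> zsf_tuples m d. gcd_tuple x m = 1}"

definition beta :: "nat \<Rightarrow> nat \<Rightarrow> nat" where
  "beta m d = card (irr_tuples m d)"

text \<open>\<open>Aut(\<int>\<^sub>n)\<close>, where \<open>k\<close> stands for the automorphism \<open>a \<mapsto> k a\<close>.\<close>

definition Aut_Z :: "nat \<Rightarrow> nat monoid" where
  "Aut_Z n = \<lparr>carrier = {k. 1 \<le> k \<and> k \<le> n - 1 \<and> gcd k n = 1},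
              monoid.mult = (\<lambda>k l. k * l mod n), one = 1\<rparr>"

definition smult_tuple :: "nat \<Rightarrow> nat \<Rightarrow> nat list \<Rightarrow> nat list" where
  "smult_tuple n k x = map (\<lambda>a. k * a mod n) x"

text \<open>The library's \<open>group_action\<close> requires each group element to act by a function that is
  extensional on the set acted upon, hence the restriction to \<open>E\<close>.\<close>

definition tuple_action :: "nat \<Rightarrow> nat list set \<Rightarrow> nat \<Rightarrow> nat list \<Rightarrow> nat list" where
  "tuple_action n E k = (\<lambda>x\<in>E. smult_tuple n k x)"

definition moebius_mu :: "nat \<Rightarrow> int" where
  "moebius_mu n = (if squarefree n then (- 1) ^ card (prime_factors n) else 0)"

lemma finite_zsf_tuples: "finite (zsf_tuples m d)"
  by (rule finite_subset[OF _ finite_lists_length_eq[of "{0..<m}" d]]) (auto simp: zsf_tuples_def)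

lemma finite_irr_tuples: "finite (irr_tuples m d)"
  using finite_zsf_tuples by (simp add: irr_tuples_def)

lemma Aut_Z_coprime: "k \<in> carrier (Aut_Z n) \<Longrightarrow> coprime k n"
  unfolding Aut_Z_def coprime_iff_gcd_eq_1 by simp

lemma Aut_Z_mult_closed:
  assumes "n \<ge> 3" "k \<in> carrier (Aut_Z n)" "l \<in> carrier (Aut_Z n)"
  shows "k * l mod n \<in> carrier (Aut_Z n)"
proof -
  have "coprime (k * l) n"
    using assms Aut_Z_coprime by simp
  then have c: "gcd (k * l mod n) n = 1"
    using assms(1) by (intro coprime_imp_gcd_eq_1) (simp add: coprime_mod_left_iff)
  then have "k * l mod n \<noteq> 0"
    using assms(1) by (intro notI) simp
  moreover have "k * l mod n < n"
    using assms(1) by simp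
  ultimately show ?thesis
    using c by (simp add: Aut_Z_def)
qed

lemma group_Aut_Z:
  assumes "n \<ge> 3"
  shows "group (Aut_Z n)"
proof (rule groupI)
  fix k l assume "k \<in> carrier (Aut_Z n)" "l \<in> carrier (Aut_Z n)"
  then show "k \<otimes>\<^bsub>Aut_Z n\<^esub> l \<in> carrier (Aut_Z n)"
    using Aut_Z_mult_closed[OF assms] by (simp add: Aut_Z_def)
next
  show "\<one>\<^bsub>Aut_Z n\<^esub> \<in> carrier (Aut_Z n)"
    using assms by (simp add: Aut_Z_def)
next
  fix k l m
  show "k \<otimes>\<^bsub>Aut_Z n\<^esub> l \<otimes>\<^bsub>Aut_Z n\<^esub> m = k \<otimes>\<^bsub>Aut_Z n\<^esub> (l \<otimes>\<^bsub>Aut_Z n\<^esub> m)"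
    by (simp add: Aut_Z_def mod_mult_left_eq mod_mult_right_eq mult.assoc)
next
  fix k assume "k \<in> carrier (Aut_Z n)"
  then show "\<one>\<^bsub>Aut_Z n\<^esub> \<otimes>\<^bsub>Aut_Z n\<^esub> k = k"
    using assms by (auto simp: Aut_Z_def intro!: mod_less)
next
  fix k assume k: "k \<in> carrier (Aut_Z n)"
  then have "coprime k n"
    by (rule Aut_Z_coprime)
  then obtain l where l: "[k * l = 1] (mod n)"
    using cong_solve_coprime_nat by auto
  have one: "l mod n * k mod n = 1"
    using l assms by (simp add: cong_def mod_mult_left_eq mod_mult_right_eq mult.commute)
  have "coprime l n"
    using l by (metis cong_imp_coprime cong_sym coprime_1_left coprime_mult_left_iff)
  then have c: "gcd (l mod n) n = 1"
    using assms by (intro coprime_imp_gcd_eq_1) (simp add: coprime_mod_left_iff)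
  have "l mod n \<noteq> 0"
    using one by (metis mod_0 mult_zero_left zero_neq_one)
  moreover have "l mod n < n"
    using assms by simp
  ultimately have "l mod n \<in> carrier (Aut_Z n)"
    using c by (simp add: Aut_Z_def)
  then show "\<exists>l\<in>carrier (Aut_Z n). l \<otimes>\<^bsub>Aut_Z n\<^esub> k = \<one>\<^bsub>Aut_Z n\<^esub>"
    using one by (intro bexI[of _ "l mod n"]) (simp_all add: Aut_Z_def)
qed

lemma smult_tuple_zsf_tuples:
  assumes "n \<ge> 3" "k \<in> carrier (Aut_Z n)" "x \<in> zsf_tuples n d"
  shows "smult_tuple n k x \<in> zsf_tuples n d"
proof -
  have cop: "coprime n k"
    using assms(2) by (metis Aut_Z_coprime coprime_commute)
  have "(\<Sum>i\<in>S. smult_tuple n k x ! i) mod n \<noteq> 0"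
    if S: "S \<subseteq> {..<length x}" "S \<noteq> {}" for S
  proof
    assume 0: "(\<Sum>i\<in>S. smult_tuple n k x ! i) mod n = 0"
    have "(\<Sum>i\<in>S. smult_tuple n k x ! i) = (\<Sum>i\<in>S. k * x ! i mod n)"
      using S by (intro sum.cong) (auto simp: smult_tuple_def)
    then have "(k * (\<Sum>i\<in>S. x ! i)) mod n = 0"
      using 0 by (simp add: mod_sum_eq sum_distrib_left)
    then have "n dvd (\<Sum>i\<in>S. x ! i)"
      using cop by (simp add: mod_eq_0_iff_dvd coprime_dvd_mult_right_iff)
    then show False
      using assms(3) S by (auto simp: zsf_tuples_def zero_sum_free_def mod_eq_0_iff_dvd)
  qed
  then show ?thesis
    using assms by (auto simp: zsf_tuples_def zero_sum_free_def smult_tuple_def)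
qed

lemma smult_tuple_irr_tuples:
  assumes "n \<ge> 3" "k \<in> carrier (Aut_Z n)" "x \<in> irr_tuples n d"
  shows "smult_tuple n k x \<in> irr_tuples n d"
proof -
  define g where "g = gcd_tuple (smult_tuple n k x) n"
  have gn: "g dvd n"
    by (simp add: g_def gcd_tuple_def)
  have "coprime n k"
    using assms(2) by (metis Aut_Z_coprime coprime_commute)
  then have cop: "coprime g k"
    using gn coprime_divisors[of g n k k] by simp
  have "g dvd a" if "a \<in> set x" for a
  proof -
    have "g dvd k * a mod n"
      unfolding g_def gcd_tuple_def by (rule Gcd_dvd) (use that in \<open>auto simp: smult_tuple_def\<close>)
    then have "g dvd k * a"
      using gn by (simp add: dvd_mod_iff)
    then show ?thesis
      using cop by (simp add: coprime_dvd_mult_right_iff)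
  qed
  then have "g dvd gcd_tuple x n"
    unfolding gcd_tuple_def using gn by (intro Gcd_greatest) auto
  then have "g = 1"
    using assms(3) by (simp add: irr_tuples_def)
  then show ?thesis
    using assms smult_tuple_zsf_tuples by (simp add: irr_tuples_def g_def)
qed

lemma group_action_tuple_action:
  assumes n: "n \<ge> 3"
    and E: "\<And>x. x \<in> E \<Longrightarrow> set x \<subseteq> {0..<n}"
    and cl: "\<And>k x. k \<in> carrier (Aut_Z n) \<Longrightarrow> x \<in> E \<Longrightarrow> smult_tuple n k x \<in> E"
  shows "group_action (Aut_Z n) E (tuple_action n E)"
proof -
  interpret A: group "Aut_Z n" using group_Aut_Z[OF n] .
  have mult: "smult_tuple n (k \<otimes>\<^bsub>Aut_Z n\<^esub> l) x = smult_tuple n k (smult_tuple n l x)" for k l x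
    by (simp add: Aut_Z_def smult_tuple_def mod_mult_left_eq mod_mult_right_eq mult.assoc)
  have one: "smult_tuple n \<one>\<^bsub>Aut_Z n\<^esub> x = x" if "x \<in> E" for x
    using E[OF that] by (auto simp: Aut_Z_def smult_tuple_def intro!: map_idI)
  have bij: "tuple_action n E k \<in> Bij E" if k: "k \<in> carrier (Aut_Z n)" for k
  proof -
    have "bij_betw (smult_tuple n k) E E"
      by (rule bij_betwI[where g = "smult_tuple n (inv\<^bsub>Aut_Z n\<^esub> k)"])
        (use k cl one in \<open>auto simp flip: mult\<close>)
    then have "bij_betw (tuple_action n E k) E E"
      by (rule bij_betw_cong[THEN iffD1, rotated]) (simp add: tuple_action_def)
    then show ?thesis
      by (simp add: Bij_def tuple_action_def)
  qed
  have "tuple_action n E (k \<otimes>\<^bsub>Aut_Z n\<^esub> l) = compose E (tuple_action n E k) (tuple_action n E l)"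
    if "k \<in> carrier (Aut_Z n)" "l \<in> carrier (Aut_Z n)" for k l
    using that cl by (auto simp: tuple_action_def compose_def mult fun_eq_iff)
  then have "tuple_action n E \<in> hom (Aut_Z n) (BijGroup E)"
    using bij by (auto simp: hom_def BijGroup_def)
  then show ?thesis
    by (simp add: group_action_def group_hom_def group_hom_axioms_def group_BijGroup
        A.group_axioms)
qed

lemma group_action_zsf_tuples:
  assumes "n \<ge> 3"
  shows "group_action (Aut_Z n) (zsf_tuples n d) (tuple_action n (zsf_tuples n d))"
proof (rule group_action_tuple_action[OF assms])
  show "set x \<subseteq> {0..<n}" if "x \<in> zsf_tuples n d" for x
    using that by (simp add: zsf_tuples_def)
qed (rule smult_tuple_zsf_tuples[OF assms])

lemma group_action_irr_tuples:
  assumes "n \<ge> 3"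
  shows "group_action (Aut_Z n) (irr_tuples n d) (tuple_action n (irr_tuples n d))"
proof (rule group_action_tuple_action[OF assms])
  show "set x \<subseteq> {0..<n}" if "x \<in> irr_tuples n d" for x
    using that by (simp add: irr_tuples_def zsf_tuples_def)
qed (rule smult_tuple_irr_tuples[OF assms])

end

theory Submission
  imports Defs
begin

text \<open>
  Parts (a) and (b): an entry \<open>a\<close> is fixed by \<open>k\<close> iff \<open>n\<close> divides \<open>(k - 1) a\<close>, so irreducible tuples
  have trivial stabilizers and all their orbits have \<open>\<phi>(n)\<close> elements. Part (c): dividing a tuple
  by its gcd \<open>g\<close> with \<open>n\<close> identifies the tuples of gcd \<open>g\<close> with the irreducible ones modulo
  \<open>n / g\<close>, and Moebius inversion gives the second formula. Part (d): among the \<open>m + 1\<close> initial partial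
  sums of \<open>m\<close> entries two coincide modulo \<open>m\<close>, so there are no zero-sum-free tuples of length at
  least \<open>m\<close>, and only the term \<open>m = n\<close> survives in (c).
\<close>

section \<open>Divisors and Moebius inversion\<close>

lemma dvd_mult_iff_div_gcd_dvd:
  fixes a b c :: "'a::semiring_gcd"
  assumes "a \<noteq> 0"
  shows "a dvd b * c \<longleftrightarrow> a div gcd b a dvd c"
proof -
  have "a div gcd b a dvd c \<longleftrightarrow> a dvd c * gcd b a"
    using assms by (simp add: div_dvd_iff_mult)
  also have "\<dots> \<longleftrightarrow> a dvd gcd (c * b) (c * a)"
    by (simp add: gcd_mult_left)
  also have "\<dots> \<longleftrightarrow> a dvd b * c"
    by (simp add: mult.commute)
  finally show ?thesis by simp
qed

lemma proper_divisor_le_half: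
  fixes m n :: nat
  assumes "m dvd n" "m < n"
  shows "2 * m \<le> n"
proof -
  obtain c where n: "n = m * c" using assms(1) by blast
  then have "c \<noteq> 0" "c \<noteq> 1" using assms(2) by auto
  then have "m * 2 \<le> m * c" by (intro mult_le_mono2) simp
  then show ?thesis by (simp add: n)
qed

lemma sum_codivisors_reflect:
  fixes f :: "nat \<Rightarrow> 'a::comm_monoid_add"
  assumes "n > 0" "e dvd n"
  shows "(\<Sum>m | e dvd m \<and> m dvd n. f (n div m)) = (\<Sum>k | k dvd n div e. f k)"
proof -
  have involution: "n div (n div m) = m" if "m dvd n" for m
    using assms(1) that by (simp add: div_div_eq_right)
  have codivisor_dvd: "n div m dvd n" if "m dvd n" for m
    using that by (metis dvd_div_mult_self dvd_triv_left)
  have "n div m dvd n div e" if m: "e dvd m" "m dvd n" for m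
  proof -
    obtain c l where "n = m * c" "m = e * l" using m by blast
    then show ?thesis using assms(1) by (simp add: mult.assoc)
  qed
  moreover have "k dvd n \<and> e dvd n div k" if k: "k dvd n div e" for k
  proof -
    obtain c l where "n = e * c" "n div e = k * l" using assms(2) k by blast
    then have "n = k * (e * l)" using assms(1) by simp
    then show ?thesis using assms(1) by simp
  qed
  ultimately show ?thesis
    using involution codivisor_dvd
    by (intro sum.reindex_bij_witness[where i = "\<lambda>k. n div k" and j = "\<lambda>m. n div m"]) simp_all
qed

lemma moebius_mu_mult_coprime:
  assumes "coprime a b"
  shows "moebius_mu (a * b) = moebius_mu a * moebius_mu b"
proof (cases "squarefree (a * b)")
  case True
  then have sqfree: "squarefree a" "squarefree b" by (auto dest: squarefree_multD)
  then have "a \<noteq> 0" "b \<noteq> 0" by (auto intro: Nat.gr0I)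
  then have "prime_factors (a * b) = prime_factors a \<union> prime_factors b"
    by (rule prime_factors_product)
  moreover have "prime_factors a \<inter> prime_factors b = {}"
    using assms by (meson coprime_common_divisor disjoint_iff in_prime_factors_imp_dvd
        in_prime_factors_imp_prime not_prime_unit)
  ultimately have "card (prime_factors (a * b)) = card (prime_factors a) + card (prime_factors b)"
    by (simp add: card_Un_disjoint)
  then show ?thesis using True sqfree by (simp add: moebius_mu_def power_add)
next
  case False
  then have "\<not> squarefree a \<or> \<not> squarefree b" using assms squarefree_mult_coprime by blast
  then show ?thesis using False by (auto simp: moebius_mu_def)
qed

lemma moebius_mu_prime: "prime p \<Longrightarrow> moebius_mu p = - 1"
  by (simp add: moebius_mu_def squarefree_prime prime_factorization_prime)

lemma moebius_mu_square_dvd_eq_0: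
  assumes "a\<^sup>2 dvd k" "a \<noteq> 1"
  shows "moebius_mu k = 0"
  using assms by (auto simp: moebius_mu_def squarefree_def)

text \<open>For a prime \<open>p\<close> dividing \<open>n\<close>, the divisors \<open>k\<close> and \<open>p k\<close> with \<open>p\<close> not dividing \<open>k\<close>
  cancel in pairs, and the remaining divisors are multiples of \<open>p\<^sup>2\<close>.\<close>

lemma sum_moebius_mu_divisors:
  assumes "n > 0"
  shows "(\<Sum>k | k dvd n. moebius_mu k) = (if n = 1 then 1 else 0)"
proof (cases "n = 1")
  case True
  then show ?thesis by (simp add: moebius_mu_def)
next
  case False
  then obtain p where p: "prime p" "p dvd n" using prime_factor_nat by blast
  define A where "A = {k. k dvd n \<and> \<not> p dvd k}"
  have coprime_A: "coprime p k" if "k \<in> A" for k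
    using p(1) that by (simp add: A_def prime_imp_coprime)
  have fin: "finite {k. k dvd n}" using assms by simp
  then have finA: "finite A" by (rule rev_finite_subset) (auto simp: A_def)
  have sub: "A \<union> (*) p ` A \<subseteq> {k. k dvd n}"
    using p(2) coprime_A by (auto simp: A_def intro: divides_mult)
  have "(\<Sum>k | k dvd n. moebius_mu k) = (\<Sum>k\<in>A \<union> (*) p ` A. moebius_mu k)"
  proof (rule sum.mono_neutral_right[OF fin sub], intro ballI)
    fix k assume k: "k \<in> {k. k dvd n} - (A \<union> (*) p ` A)"
    then obtain l where l: "k = p * l" by (auto simp: A_def)
    then have "l dvd n" using k dvd_mult_right by blast
    then have "p dvd l" using k l by (auto simp: A_def)
    then show "moebius_mu k = 0"
      using p(1) l by (intro moebius_mu_square_dvd_eq_0[of p]) (auto simp: power2_eq_square)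
  qed
  also have "\<dots> = (\<Sum>k\<in>A. moebius_mu k) + (\<Sum>k\<in>(*) p ` A. moebius_mu k)"
    using finA by (intro sum.union_disjoint) (auto simp: A_def)
  also have "(\<Sum>k\<in>(*) p ` A. moebius_mu k) = (\<Sum>k\<in>A. moebius_mu (p * k))"
    using p(1) by (subst sum.reindex) (auto simp: inj_on_def)
  also have "\<dots> = - (\<Sum>k\<in>A. moebius_mu k)"
    using p(1) by (simp add: moebius_mu_mult_coprime coprime_A moebius_mu_prime sum_negf)
  finally show ?thesis using False by simp
qed

theorem moebius_inversion:
  fixes f g :: "nat \<Rightarrow> 'a::ring_1"
  assumes n: "n > 0" and f: "\<And>m. m dvd n \<Longrightarrow> f m = (\<Sum>e | e dvd m. g e)"
  shows "(\<Sum>m | m dvd n. of_int (moebius_mu (n div m)) * f m) = g n"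
proof -
  let ?\<mu> = "\<lambda>m. of_int (moebius_mu m) :: 'a"
  have fin: "finite {m. m dvd n}" using n by simp
  have coeff: "(\<Sum>m | m dvd n \<and> e dvd m. ?\<mu> (n div m)) = (if e = n then 1 else 0)"
    if e: "e dvd n" for e
  proof -
    have "(\<Sum>m | m dvd n \<and> e dvd m. ?\<mu> (n div m)) = (\<Sum>k | k dvd n div e. ?\<mu> k)"
      using sum_codivisors_reflect[OF n e, of ?\<mu>] by (simp add: conj_commute)
    also have "\<dots> = of_int (if n div e = 1 then 1 else 0)"
      using n e by (subst sum_moebius_mu_divisors[symmetric]) (auto elim!: dvdE)
    also have "n div e = 1 \<longleftrightarrow> e = n" using n e by (auto elim!: dvdE)
    finally show ?thesis by simp
  qed
  have "(\<Sum>m | m dvd n. ?\<mu> (n div m) * f m)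
      = (\<Sum>m | m dvd n. \<Sum>e | e dvd n \<and> e dvd m. ?\<mu> (n div m) * g e)"
  proof (rule sum.cong[OF refl])
    fix m assume m: "m \<in> {m. m dvd n}"
    then have "{e. e dvd n \<and> e dvd m} = {e. e dvd m}" by (auto intro: dvd_trans)
    then show "?\<mu> (n div m) * f m = (\<Sum>e | e dvd n \<and> e dvd m. ?\<mu> (n div m) * g e)"
      using m by (simp add: f sum_distrib_left)
  qed
  also have "\<dots> = (\<Sum>e | e dvd n. (\<Sum>m | m dvd n \<and> e dvd m. ?\<mu> (n div m)) * g e)"
    using sum.swap_restrict[OF fin fin, of "\<lambda>m e. ?\<mu> (n div m) * g e" "\<lambda>m e. e dvd m"]
    by (simp add: sum_distrib_right)
  also have "\<dots> = (\<Sum>e | e dvd n. if e = n then g e else 0)"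
    by (intro sum.cong) (simp_all add: coeff)
  also have "\<dots> = g n" using fin by simp
  finally show ?thesis .
qed

section \<open>Counting zero-sum-free tuples by their gcd\<close>

lemma dvd_gcd_tuple_iff: "c dvd gcd_tuple x m \<longleftrightarrow> c dvd m \<and> (\<forall>a\<in>set x. c dvd a)"
  by (simp add: gcd_tuple_def dvd_Gcd_iff)

lemma gcd_tuple_map_mult: "gcd_tuple (map ((*) g) x) (g * m) = g * gcd_tuple x m"
proof -
  have "gcd_tuple (map ((*) g) x) (g * m) = Gcd ((*) g ` insert m (set x))"
    by (simp add: gcd_tuple_def)
  also have "\<dots> = g * gcd_tuple x m"
    by (simp only: Gcd_mult gcd_tuple_def normalize_nat_def id_apply)
  finally show ?thesis .
qed

lemma zero_sum_free_map_mult: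
  assumes "g > 0"
  shows "zero_sum_free (g * m) (map ((*) g) x) \<longleftrightarrow> zero_sum_free m x"
proof -
  have "(\<Sum>i\<in>S. map ((*) g) x ! i) mod (g * m) = g * ((\<Sum>i\<in>S. x ! i) mod m)"
    if "S \<subseteq> {..<length x}" for S
  proof -
    have "(\<Sum>i\<in>S. map ((*) g) x ! i) = g * (\<Sum>i\<in>S. x ! i)"
      unfolding sum_distrib_left using that by (intro sum.cong) auto
    then show ?thesis by (simp only: mult_mod_right)
  qed
  then show ?thesis using assms by (auto simp: zero_sum_free_def)
qed

lemma zsf_tuples_gcd_eq:
  assumes "g > 0"
  shows "{x \<in> zsf_tuples (g * m) d. gcd_tuple x (g * m) = g} = map ((*) g) ` irr_tuples m d"
proof -
  have multiple: "map ((*) g) y \<in> zsf_tuples (g * m) d \<and> gcd_tuple (map ((*) g) y) (g * m) = g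
      \<longleftrightarrow> y \<in> irr_tuples m d" for y
    using assms
    by (auto simp: zsf_tuples_def irr_tuples_def zero_sum_free_map_mult gcd_tuple_map_mult)
  have "x \<in> range (map ((*) g))" if "gcd_tuple x (g * m) = g" for x
  proof -
    have "\<forall>a\<in>set x. g dvd a" using that dvd_gcd_tuple_iff[of g x "g * m"] by simp
    then have "x = map ((*) g) (map (\<lambda>a. a div g) x)" by (simp add: map_idI)
    then show ?thesis by blast
  qed
  then show ?thesis using multiple by blast
qed

lemma card_zsf_tuples_gcd_eq:
  assumes "g > 0"
  shows "card {x \<in> zsf_tuples (g * m) d. gcd_tuple x (g * m) = g} = beta m d"
proof -
  have "inj (map ((*) g))" using assms by (intro inj_mapI) (simp add: inj_on_def)
  then have "inj_on (map ((*) g)) (irr_tuples m d)" by (rule inj_on_subset) simp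
  then show ?thesis by (simp add: zsf_tuples_gcd_eq[OF assms] card_image beta_def)
qed

theorem alpha_eq_sum_beta:
  assumes "n > 0"
  shows "alpha n d = (\<Sum>m | m dvd n. beta m d)"
proof -
  have "finite {g. g dvd n}" using assms by simp
  moreover have "(\<lambda>x. gcd_tuple x n) ` zsf_tuples n d \<subseteq> {g. g dvd n}"
    by (auto simp: gcd_tuple_def)
  ultimately have "alpha n d = (\<Sum>g | g dvd n. card {x \<in> zsf_tuples n d. gcd_tuple x n = g})"
    using sum.group[OF finite_zsf_tuples, of "{g. g dvd n}" "\<lambda>x. gcd_tuple x n" n d "\<lambda>_. 1 :: nat"]
    by (simp add: alpha_def)
  also have "\<dots> = (\<Sum>g | g dvd n. beta (n div g) d)"
  proof (rule sum.cong[OF refl])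
    fix g assume "g \<in> {g. g dvd n}"
    then obtain m where n: "n = g * m" by auto
    then have "g > 0" using assms by auto
    then show "card {x \<in> zsf_tuples n d. gcd_tuple x n = g} = beta (n div g) d"
      by (simp add: n card_zsf_tuples_gcd_eq)
  qed
  also have "\<dots> = (\<Sum>m | m dvd n. beta m d)"
    using sum_codivisors_reflect[OF assms one_dvd, of "\<lambda>m. beta m d"] by simp
  finally show ?thesis .
qed

lemma obtain_block_sum_dvd:
  fixes f :: "nat \<Rightarrow> nat"
  assumes "m > 0"
  obtains i j where "i < j" "j \<le> m" "m dvd sum f {i..<j}"
proof -
  define s where "s j = sum f {..<j}" for j
  have "card ((\<lambda>j. s j mod m) ` {..m}) \<le> card {..<m}"
    using assms by (intro card_mono) auto
  then have "\<not> inj_on (\<lambda>j. s j mod m) {..m}"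
    by (intro pigeonhole) simp
  then obtain i j where ij: "i < j" "j \<le> m" "s i mod m = s j mod m"
    unfolding inj_on_def by (metis atMost_iff linorder_neqE_nat)
  have "s j = s i + sum f {i..<j}"
    using ij(1) by (simp add: s_def lessThan_atLeast0 sum.atLeastLessThan_concat)
  then have "m dvd sum f {i..<j}"
    using ij(3) by (metis add_diff_cancel_left' le_add1 mod_eq_dvd_iff_nat)
  then show ?thesis using that ij(1,2) by blast
qed

lemma zsf_tuples_empty:
  assumes "m > 0" "m \<le> d"
  shows "zsf_tuples m d = {}"
proof -
  have "\<not> zero_sum_free m x" if "length x = d" for x
  proof -
    obtain i j where "i < j" "j \<le> m" "m dvd (\<Sum>l = i..<j. x ! l)"
      using obtain_block_sum_dvd[OF assms(1)] .
    then have "{i..<j} \<subseteq> {..<length x}" "{i..<j} \<noteq> {}" "(\<Sum>l = i..<j. x ! l) mod m = 0"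
      using assms(2) that by auto
    then show ?thesis by (simp only: zero_sum_free_def) metis
  qed
  then show ?thesis by (auto simp: zsf_tuples_def)
qed

lemma alpha_eq_beta:
  assumes "n > 0" and divisors_le: "\<And>m. m dvd n \<Longrightarrow> m < n \<Longrightarrow> m \<le> d"
  shows "alpha n d = beta n d"
proof -
  have "beta m d = 0" if "m dvd n" "m \<noteq> n" for m
  proof -
    have "m > 0" "m < n" using that assms(1) by (auto simp: dvd_pos_nat dest: dvd_imp_le)
    then have "zsf_tuples m d = {}" using that(1) divisors_le zsf_tuples_empty by blast
    then show ?thesis by (simp add: beta_def irr_tuples_def)
  qed
  then have "(\<Sum>m | m dvd n. beta m d) = (\<Sum>m\<in>{n}. beta m d)"
    using assms(1) by (intro sum.mono_neutral_right) auto
  then show ?thesis using alpha_eq_sum_beta[OF assms(1)] by simp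
qed

corollary alpha_eq_beta_if_Max_proper_divisor_le:
  assumes "n > 0" "Max {m. 1 \<le> m \<and> m < n \<and> m dvd n} \<le> d"
  shows "alpha n d = beta n d"
proof (rule alpha_eq_beta[OF assms(1)])
  fix m assume "m dvd n" "m < n"
  then have "m \<le> Max {m. 1 \<le> m \<and> m < n \<and> m dvd n}"
    using dvd_pos_nat[OF assms(1)] by (intro Max_ge) (auto simp: Suc_le_eq)
  then show "m \<le> d" using assms(2) by simp
qed

corollary alpha_eq_beta_if_half_le:
  assumes "n > 0" "n \<le> 2 * d"
  shows "alpha n d = beta n d"
proof (rule alpha_eq_beta[OF assms(1)])
  show "m \<le> d" if "m dvd n" "m < n" for m
    using proper_divisor_le_half[OF that] assms(2) by simp
qed

section \<open>Stabilizers and orbits\<close>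

lemma mult_mod_eq_self_iff:
  fixes k a n :: nat
  assumes "k \<ge> 1" "a < n"
  shows "k * a mod n = a \<longleftrightarrow> n div gcd (k - 1) n dvd a"
proof -
  have "k * a mod n = a \<longleftrightarrow> k * a mod n = a mod n" using assms(2) by simp
  also have "\<dots> \<longleftrightarrow> n dvd k * a - a"
    using assms(1) by (intro mod_eq_dvd_iff_nat) simp
  also have "k * a - a = (k - 1) * a" by (simp add: diff_mult_distrib)
  also have "n dvd \<dots> \<longleftrightarrow> n div gcd (k - 1) n dvd a"
    using assms(2) by (intro dvd_mult_iff_div_gcd_dvd) simp
  finally show ?thesis .
qed

lemma smult_tuple_eq_self_iff:
  assumes "k \<ge> 1" "set x \<subseteq> {0..<n}"
  shows "smult_tuple n k x = x \<longleftrightarrow> n div gcd (k - 1) n dvd gcd_tuple x n"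
proof -
  have "smult_tuple n k x = x \<longleftrightarrow> (\<forall>a\<in>set x. k * a mod n = a)"
    using map_eq_conv[of "\<lambda>a. k * a mod n" x id] by (simp add: smult_tuple_def)
  also have "\<dots> \<longleftrightarrow> (\<forall>a\<in>set x. n div gcd (k - 1) n dvd a)"
    using assms by (intro ball_cong) (auto simp: mult_mod_eq_self_iff)
  also have "\<dots> \<longleftrightarrow> n div gcd (k - 1) n dvd gcd_tuple x n"
    using dvd_triv_left[of "n div gcd (k - 1) n" "gcd (k - 1) n"] by (auto simp: dvd_gcd_tuple_iff)
  finally show ?thesis .
qed

lemma stabilizer_tuple_action_iff:
  assumes "x \<in> E" "set x \<subseteq> {0..<n}" "k \<in> carrier (Aut_Z n)"
  shows "k \<in> stabilizer (Aut_Z n) (tuple_action n E) x \<longleftrightarrow> n div gcd (k - 1) n dvd gcd_tuple x n"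
proof -
  have "k \<ge> 1" using assms(3) by (simp add: Aut_Z_def)
  then show ?thesis
    using assms by (simp add: stabilizer_def tuple_action_def smult_tuple_eq_self_iff)
qed

lemma stabilizer_tuple_action_irreducible:
  assumes "n \<ge> 2" "x \<in> E" "set x \<subseteq> {0..<n}" "gcd_tuple x n = 1"
  shows "stabilizer (Aut_Z n) (tuple_action n E) x = {1}"
proof -
  have "k \<in> stabilizer (Aut_Z n) (tuple_action n E) x \<longleftrightarrow> k = 1"
    if k: "k \<in> carrier (Aut_Z n)" for k
  proof -
    have "1 \<le> k" "k < n" using k assms(1) by (auto simp: Aut_Z_def)
    have "k \<in> stabilizer (Aut_Z n) (tuple_action n E) x \<longleftrightarrow> n div gcd (k - 1) n dvd 1"
      by (simp only: stabilizer_tuple_action_iff[OF assms(2,3) k] assms(4))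
    also have "\<dots> \<longleftrightarrow> n dvd k - 1"
      using assms(1) by (subst dvd_mult_iff_div_gcd_dvd[symmetric]) simp_all
    also have "\<dots> \<longleftrightarrow> k = 1"
      using \<open>1 \<le> k\<close> \<open>k < n\<close> by (auto dest: dvd_imp_le)
    finally show ?thesis .
  qed
  moreover have "1 \<in> carrier (Aut_Z n)" using assms(1) by (simp add: Aut_Z_def)
  moreover have "stabilizer (Aut_Z n) (tuple_action n E) x \<subseteq> carrier (Aut_Z n)"
    by (auto simp: stabilizer_def)
  ultimately show ?thesis by blast
qed

lemma carrier_Aut_Z:
  assumes "n \<ge> 2"
  shows "carrier (Aut_Z n) = totatives n"
proof -
  have not_coprime_self: "k \<noteq> n" if "coprime k n" for k
    using that assms by auto
  have "k \<in> totatives n \<longleftrightarrow> 1 \<le> k \<and> k \<le> n - 1 \<and> coprime k n" for k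
    using assms not_coprime_self[of k] unfolding in_totatives_iff by linarith
  then show ?thesis
    unfolding Aut_Z_def coprime_iff_gcd_eq_1 by auto
qed

lemma (in group_action) order_mult_card_orbits_if_free:
  assumes "finite (carrier G)" "finite E" and free: "\<And>x. x \<in> E \<Longrightarrow> stabilizer G \<phi> x = {\<one>}"
  shows "order G * card (orbits G E \<phi>) = card E"
proof -
  have "order G * card (orbits G E \<phi>) = (\<Sum>orb\<in>orbits G E \<phi>. \<Sum>x\<in>orb. card (stabilizer G \<phi> x))"
    using card_stablizer_sum[OF assms(1)] by simp
  also have "\<dots> = (\<Sum>x\<in>E. card (stabilizer G \<phi> x))"
    by (rule disjoint_sum[OF assms(2)])
  also have "\<dots> = card E"
    by (simp add: free)
  finally show ?thesis .
qed

lemma totient_mult_card_orbits: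
  assumes "n \<ge> 3"
  shows "totient n * card (orbits (Aut_Z n) (irr_tuples n d) (tuple_action n (irr_tuples n d)))
    = beta n d"
proof -
  interpret group_action "Aut_Z n" "irr_tuples n d" "tuple_action n (irr_tuples n d)"
    by (rule group_action_irr_tuples[OF assms])
  have carrier: "carrier (Aut_Z n) = totatives n"
    using assms by (intro carrier_Aut_Z) simp
  have free: "stabilizer (Aut_Z n) (tuple_action n (irr_tuples n d)) x = {\<one>\<^bsub>Aut_Z n\<^esub>}"
    if "x \<in> irr_tuples n d" for x
    using stabilizer_tuple_action_irreducible[OF _ that] that assms
    by (simp add: Aut_Z_def irr_tuples_def zsf_tuples_def)
  have "order (Aut_Z n) = totient n"
    by (simp add: order_def carrier totient_def)
  then show ?thesis
    using order_mult_card_orbits_if_free[OF _ finite_irr_tuples free] by (simp add: carrier beta_def)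
qed

theorem theorem2p2:
  fixes n d :: nat
  assumes "n \<ge> 3" and "1 \<le> d" and "d < n"
  shows
    "((\<forall>k\<in>carrier (Aut_Z n). \<forall>x\<in>zsf_tuples n d.
         k \<in> stabilizer (Aut_Z n) (tuple_action n (zsf_tuples n d)) x
           \<longleftrightarrow> n div gcd (k - 1) n dvd gcd_tuple x n) \<and>
      (\<forall>x\<in>zsf_tuples n d. gcd_tuple x n = 1 \<longrightarrow>
         stabilizer (Aut_Z n) (tuple_action n (zsf_tuples n d)) x = {1})) \<and>
     (real (card (orbits (Aut_Z n) (irr_tuples n d) (tuple_action n (irr_tuples n d))))
         = real (beta n d) / real (totient n) \<and>
      totient n dvd beta n d) \<and>
     (alpha n d = (\<Sum>m | m dvd n \<and> m \<ge> 1. beta m d) \<and>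
      int (beta n d) = (\<Sum>m | m dvd n \<and> m \<ge> 1. moebius_mu (n div m) * int (alpha m d))) \<and>
     ((d \<ge> Max {m. 1 \<le> m \<and> m < n \<and> m dvd n} \<longrightarrow>
         alpha n d = beta n d \<and> totient n dvd alpha n d) \<and>
      (real d \<ge> real n / 2 \<longrightarrow>
         alpha n d = beta n d \<and> totient n dvd alpha n d))"
proof (intro conjI ballI impI)
  have n: "n > 0" using assms(1) by simp
  then have divisors: "{m. m dvd n \<and> m \<ge> 1} = {m. m dvd n}"
    using dvd_pos_nat[of n] by (auto simp: Suc_le_eq)
  show "k \<in> stabilizer (Aut_Z n) (tuple_action n (zsf_tuples n d)) x
      \<longleftrightarrow> n div gcd (k - 1) n dvd gcd_tuple x n"
    if "k \<in> carrier (Aut_Z n)" "x \<in> zsf_tuples n d" for k x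
    using that by (intro stabilizer_tuple_action_iff) (auto simp: zsf_tuples_def)
  show "stabilizer (Aut_Z n) (tuple_action n (zsf_tuples n d)) x = {1}"
    if "x \<in> zsf_tuples n d" "gcd_tuple x n = 1" for x
    using assms(1) that by (intro stabilizer_tuple_action_irreducible) (auto simp: zsf_tuples_def)
  note orbits = totient_mult_card_orbits[OF assms(1), of d]
  show totient_dvd: "totient n dvd beta n d" by (simp flip: orbits)
  show "real (card (orbits (Aut_Z n) (irr_tuples n d) (tuple_action n (irr_tuples n d))))
      = real (beta n d) / real (totient n)"
    using n by (simp flip: orbits)
  show "alpha n d = (\<Sum>m | m dvd n \<and> m \<ge> 1. beta m d)"
    unfolding divisors by (rule alpha_eq_sum_beta[OF n])
  show "int (beta n d) = (\<Sum>m | m dvd n \<and> m \<ge> 1. moebius_mu (n div m) * int (alpha m d))"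
    unfolding divisors
    using moebius_inversion[OF n, of "\<lambda>m. int (alpha m d)" "\<lambda>m. int (beta m d)"] n
    by (simp add: alpha_eq_sum_beta dvd_pos_nat)
  show "alpha n d = beta n d" "totient n dvd alpha n d"
    if "d \<ge> Max {m. 1 \<le> m \<and> m < n \<and> m dvd n}"
    using alpha_eq_beta_if_Max_proper_divisor_le[OF n that] totient_dvd by simp_all
  show "alpha n d = beta n d" "totient n dvd alpha n d" if "real d \<ge> real n / 2"
    using alpha_eq_beta_if_half_le[OF n, of d] that totient_dvd by simp_all
qed

end
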